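(* Let $S$ be a quasi-thin scheme on $X$, $\mathbb F$ a field and $x\in X$. Then for every $y\in X$, the Terwilliger $\mathbb F$-algebra $\mathcal T(y)$ of $S$ with respect to $y$ is isomorphic to $\mathcal T(x)$ as $\mathbb F$-algebras.
   Context: Let $X$ be a nonempty finite set. A scheme of class $d$ on $X$ is a partition $S=\{R_0,\dots,R_d\}$ of $X\times X$ into nonempty sets such that $R_0=\{(b,b):b\in X\}$; for each $c$ there is $c'$ with $R_{c'}=\{(f,e):(e,f)\in R_c\}$; and for all $i,j,k$ the intersection number $p_{ij}^k=|\{\ell\in X:(m,\ell)\in R_i,(\ell,n)\in R_j\}|$ does not depend on $(m,n)\in R_k$. The valency of $R_a$ is $k_a=p_{aa'}^0$; $S$ is quasi-thin if all $k_a\le 2$. For $y\in X$, $yR_a=\{z:(y,z)\in R_a\}$. $A_a\in M_X(\mathbb F)$ is the $(0,1)$ adjacency matrix of $R_a$ and $E_a^*(y)$ is the diagonal $(0,1)$-matrix with ones exactly at positions indexed by $yR_a$. The Terwilliger $\mathbb F$-algebra $\mathcal T(y)$ is the $\mathbb F$-subalgebra of $M_X(\mathbb F)$ generated by $A_0,\dots,A_d,E_0^*(y),\dots,E_d^*(y)$. *)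

theory Defs
  imports Main
begin

text \<open>The finite set X is modelled as the universe of a finite type 'a (nonempty
automatically). A scheme of class d is given by relations R 0, ..., R d.\<close>

definition int_num :: "(nat \<Rightarrow> ('a \<times> 'a) set) \<Rightarrow> nat \<Rightarrow> nat \<Rightarrow> 'a \<Rightarrow> 'a \<Rightarrow> nat" where
  "int_num R i j m n = card {l. (m, l) \<in> R i \<and> (l, n) \<in> R j}"

definition scheme :: "nat \<Rightarrow> (nat \<Rightarrow> ('a::finite \<times> 'a) set) \<Rightarrow> bool" where
  "scheme d R \<longleftrightarrow>
     (\<forall>i\<le>d. R i \<noteq> {}) \<and>
     (\<forall>i\<le>d. \<forall>j\<le>d. i \<noteq> j \<longrightarrow> R i \<inter> R j = {}) \<and>
     (\<Union>i\<in>{0..d}. R i) = UNIV \<and>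
     R 0 = {(b, b) | b. True} \<and>
     (\<forall>c\<le>d. \<exists>c'\<le>d. R c' = {(f, e). (e, f) \<in> R c}) \<and>
     (\<forall>i\<le>d. \<forall>j\<le>d. \<forall>k\<le>d. \<exists>p. \<forall>(m, n)\<in>R k. int_num R i j m n = p)"

text \<open>Intersection number p_ij^k (well defined for a scheme).\<close>
definition p_num :: "(nat \<Rightarrow> ('a \<times> 'a) set) \<Rightarrow> nat \<Rightarrow> nat \<Rightarrow> nat \<Rightarrow> nat" where
  "p_num R i j k = (SOME p. \<forall>(m, n)\<in>R k. int_num R i j m n = p)"

definition conv_idx :: "nat \<Rightarrow> (nat \<Rightarrow> ('a \<times> 'a) set) \<Rightarrow> nat \<Rightarrow> nat" where
  "conv_idx d R c = (SOME c'. c' \<le> d \<and> R c' = {(f, e). (e, f) \<in> R c})"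

definition valency :: "nat \<Rightarrow> (nat \<Rightarrow> ('a \<times> 'a) set) \<Rightarrow> nat \<Rightarrow> nat" where
  "valency d R a = p_num R a (conv_idx d R a) 0"

definition quasi_thin :: "nat \<Rightarrow> (nat \<Rightarrow> ('a::finite \<times> 'a) set) \<Rightarrow> bool" where
  "quasi_thin d R \<longleftrightarrow> (\<forall>a\<le>d. valency d R a \<le> 2)"

type_synonym ('a, 'f) xmat = "'a \<Rightarrow> 'a \<Rightarrow> 'f"

definition mmult :: "('a::finite, 'f::field) xmat \<Rightarrow> ('a, 'f) xmat \<Rightarrow> ('a, 'f) xmat" where
  "mmult A B = (\<lambda>i j. \<Sum>k\<in>UNIV. A i k * B k j)"

definition madd :: "('a, 'f::field) xmat \<Rightarrow> ('a, 'f) xmat \<Rightarrow> ('a, 'f) xmat" where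
  "madd A B = (\<lambda>i j. A i j + B i j)"

definition msmult :: "'f::field \<Rightarrow> ('a, 'f) xmat \<Rightarrow> ('a, 'f) xmat" where
  "msmult c A = (\<lambda>i j. c * A i j)"

definition mzero :: "('a, 'f::field) xmat" where
  "mzero = (\<lambda>i j. 0)"

definition mone :: "('a, 'f::field) xmat" where
  "mone = (\<lambda>i j. if i = j then 1 else 0)"

inductive_set gen_alg :: "('a::finite, 'f::field) xmat set \<Rightarrow> ('a, 'f) xmat set"
  for G where
  gen: "A \<in> G \<Longrightarrow> A \<in> gen_alg G"
| one: "mone \<in> gen_alg G"
| zero: "mzero \<in> gen_alg G"
| add: "A \<in> gen_alg G \<Longrightarrow> B \<in> gen_alg G \<Longrightarrow> madd A B \<in> gen_alg G"
| smult: "A \<in> gen_alg G \<Longrightarrow> msmult c A \<in> gen_alg G"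
| mult: "A \<in> gen_alg G \<Longrightarrow> B \<in> gen_alg G \<Longrightarrow> mmult A B \<in> gen_alg G"

definition adj_mat :: "(nat \<Rightarrow> ('a \<times> 'a) set) \<Rightarrow> nat \<Rightarrow> ('a, 'f::field) xmat" where
  "adj_mat R a = (\<lambda>i j. if (i, j) \<in> R a then 1 else 0)"

definition dual_idem :: "(nat \<Rightarrow> ('a \<times> 'a) set) \<Rightarrow> 'a \<Rightarrow> nat \<Rightarrow> ('a, 'f::field) xmat" where
  "dual_idem R y a = (\<lambda>i j. if i = j \<and> (y, i) \<in> R a then 1 else 0)"

definition terwilliger :: "nat \<Rightarrow> (nat \<Rightarrow> ('a::finite \<times> 'a) set) \<Rightarrow> 'a \<Rightarrow> ('a, 'f::field) xmat set" where
  "terwilliger d R y = gen_alg ({adj_mat R a | a. a \<le> d} \<union> {dual_idem R y a | a. a \<le> d})"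

definition alg_iso :: "('a::finite, 'f::field) xmat set \<Rightarrow> ('b::finite, 'f) xmat set
     \<Rightarrow> (('a, 'f) xmat \<Rightarrow> ('b, 'f) xmat) \<Rightarrow> bool" where
  "alg_iso A B \<phi> \<longleftrightarrow> bij_betw \<phi> A B \<and>
     (\<forall>M\<in>A. \<forall>N\<in>A. \<phi> (madd M N) = madd (\<phi> M) (\<phi> N)) \<and>
     (\<forall>c. \<forall>M\<in>A. \<phi> (msmult c M) = msmult c (\<phi> M)) \<and>
     (\<forall>M\<in>A. \<forall>N\<in>A. \<phi> (mmult M N) = mmult (\<phi> M) (\<phi> N)) \<and>
     \<phi> mone = mone"

end

theory Submission
  imports Defs
begin

text \<open>Cut a matrix into the blocks indexed by \<open>yR\<^sub>b \<times> yR\<^sub>c\<close>. The row and column sums of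
the \<open>(b, c)\<close> block of \<open>A\<^sub>a\<close> are intersection numbers, so they do not depend on \<open>y\<close>, and quasi-thinness
makes the block at most \<open>2 \<times> 2\<close>. Hence the block is zero, all ones, or one of the two
\<open>2 \<times> 2\<close> permutation matrices, and only in the last case can it vary with \<open>y\<close>. Any bijection of \<open>X\<close>
taking each \<open>xR\<^sub>a\<close> to \<open>yR\<^sub>a\<close> therefore turns the block at \<open>y\<close> into the block at \<open>x\<close> or into its
complement in the all-ones block, and both lie in \<open>\<T>(x)\<close>. So reindexing by this bijection maps
\<open>\<T>(y)\<close> into \<open>\<T>(x)\<close>, and reindexing by its inverse maps back.\<close>

section \<open>Reindexing matrices\<close>

text \<open>For bijective \<open>\<sigma>\<close> this is conjugation by a permutation matrix, hence
  an isomorphism of full matrix algebras.\<close>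

definition reindex :: "('b \<Rightarrow> 'a) \<Rightarrow> ('a, 'f) xmat \<Rightarrow> ('b, 'f) xmat" where
  "reindex \<sigma> M = (\<lambda>i j. M (\<sigma> i) (\<sigma> j))"

lemma reindex_madd: "reindex \<sigma> (madd M N) = madd (reindex \<sigma> M) (reindex \<sigma> N)"
  by (simp add: reindex_def madd_def)

lemma reindex_msmult: "reindex \<sigma> (msmult c M) = msmult c (reindex \<sigma> M)"
  by (simp add: reindex_def msmult_def)

lemma reindex_mzero: "reindex \<sigma> mzero = mzero"
  by (simp add: reindex_def mzero_def)

lemma reindex_mone: "inj \<sigma> \<Longrightarrow> reindex \<sigma> mone = mone"
  by (auto simp: reindex_def mone_def fun_eq_iff dest: injD)

lemma reindex_mmult:
  assumes "bij \<sigma>"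
  shows "reindex \<sigma> (mmult M N) = mmult (reindex \<sigma> M) (reindex \<sigma> N)"
proof (intro ext)
  fix i j
  show "reindex \<sigma> (mmult M N) i j = mmult (reindex \<sigma> M) (reindex \<sigma> N) i j"
    unfolding reindex_def mmult_def
    by (rule sum.reindex_bij_betw[OF assms, symmetric])
qed

lemma reindex_inv:
  assumes "bij \<sigma>"
  shows "reindex \<sigma> (reindex (inv \<sigma>) M) = M" "reindex (inv \<sigma>) (reindex \<sigma> N) = N"
  using assms by (simp_all add: reindex_def bij_is_inj bij_is_surj surj_f_inv_f)

text \<open>Reindexing along a bijection is an algebra homomorphism, so only the generators need
  checking.\<close>

lemma reindex_gen_alg:
  assumes "bij \<sigma>" and "\<And>M. M \<in> G \<Longrightarrow> reindex \<sigma> M \<in> gen_alg H" and "M \<in> gen_alg G"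
  shows "reindex \<sigma> M \<in> gen_alg H"
  using assms(3)
proof induction
  case one
  then show ?case using assms(1) by (simp add: reindex_mone bij_is_inj gen_alg.one)
qed (simp_all add: assms reindex_madd reindex_msmult reindex_mzero reindex_mmult gen_alg.intros)

lemma alg_iso_reindex:
  assumes "bij \<sigma>"
    and "\<And>M. M \<in> A \<Longrightarrow> reindex \<sigma> M \<in> B"
    and "\<And>M. M \<in> B \<Longrightarrow> reindex (inv \<sigma>) M \<in> A"
  shows "alg_iso A B (reindex \<sigma>)"
proof -
  have "bij_betw (reindex \<sigma>) A B"
    by (rule bij_betw_byWitness[where f' = "reindex (inv \<sigma>)"])
      (use assms in \<open>auto simp: reindex_inv\<close>)
  then show ?thesis
    using assms(1)
    by (simp add: alg_iso_def reindex_madd reindex_msmult reindex_mmult reindex_mone bij_is_inj)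
qed

lemma gen_alg_sum:
  assumes "finite K" and "\<And>k. k \<in> K \<Longrightarrow> f k \<in> gen_alg G"
  shows "(\<lambda>i j. \<Sum>k\<in>K. f k i j) \<in> gen_alg G"
  using assms
proof (induction K rule: finite_induct)
  case empty
  then show ?case using gen_alg.zero[of G] by (simp add: mzero_def)
next
  case (insert k K)
  then have "madd (f k) (\<lambda>i j. \<Sum>k\<in>K. f k i j) \<in> gen_alg G"
    by (intro gen_alg.add) auto
  with insert.hyps show ?case by (simp add: madd_def)
qed

section \<open>Small biregular relations\<close>

lemma card_le_2_cases:
  assumes "finite A" and "card A \<le> 2"
  obtains "A = {}" | a where "A = {a}" | a b where "A = {a, b}" and "a \<noteq> b"
proof -
  have "card A = 0 \<or> card A = 1 \<or> card A = 2" using assms(2) by linarith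
  with assms(1) that show ?thesis by (auto simp: card_1_singleton_iff card_2_iff)
qed

text \<open>With one row or one column, the sums across it force all entries to agree; a 2 by 2
  relation is constant or a permutation matrix. The bound 2 is essential: on three points the
  identity and a 3-cycle both have \<open>p = q = 1\<close>, yet are neither equal nor
  complementary.\<close>

lemma biregular_unique_up_to_complement:
  fixes P Q :: "'a \<Rightarrow> 'b \<Rightarrow> bool"
  assumes U: "finite U" "card U \<le> 2" and V: "finite V" "card V \<le> 2"
    and row: "\<And>i. i \<in> U \<Longrightarrow> card {j\<in>V. P i j} = p" "\<And>i. i \<in> U \<Longrightarrow> card {j\<in>V. Q i j} = p"
    and col: "\<And>j. j \<in> V \<Longrightarrow> card {i\<in>U. P i j} = q" "\<And>j. j \<in> V \<Longrightarrow> card {i\<in>U. Q i j} = q"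
  shows "(\<forall>i\<in>U. \<forall>j\<in>V. P i j \<longleftrightarrow> Q i j) \<or> (\<forall>i\<in>U. \<forall>j\<in>V. P i j \<longleftrightarrow> \<not> Q i j)"
proof -
  \<comment> \<open>Counts become sums of 0/1 values, so that the cases below reduce to linear
    arithmetic.\<close>
  have count: "card {j\<in>W. T j} = (\<Sum>j\<in>W. of_bool (T j))"
    if "finite W" for W :: "'c set" and T
    using that by (simp add: of_bool_def sum.If_cases Int_def)
  note row = row[unfolded count[OF V(1)]] and col = col[unfolded count[OF U(1)]]
  show ?thesis
    using U
  proof (cases rule: card_le_2_cases)
    case 1
    then show ?thesis by simp
  next
    case u: (2 u)
    show ?thesis
      using V
    proof (cases rule: card_le_2_cases)
      case 1
      then show ?thesis by simp
    next
      \<comment> \<open>Two truth values are equal or opposite, so a single entry needs no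
        counting.\<close>
      case v: (2 v)
      then show ?thesis using u by auto
    next
      case v: (3 v v')
      have "of_bool (P u v) = q" "of_bool (P u v') = q" "of_bool (Q u v) = q" "of_bool (Q u v') = q"
        using col[of v] col[of v'] u v by (simp_all del: sum_of_bool_eq)
      then show ?thesis
        unfolding u v by (cases "P u v"; cases "P u v'"; cases "Q u v"; cases "Q u v'"; simp)
    qed
  next
    case u: (3 u u')
    show ?thesis
      using V
    proof (cases rule: card_le_2_cases)
      case 1
      then show ?thesis by simp
    next
      case v: (2 v)
      have "of_bool (P u v) = p" "of_bool (P u' v) = p" "of_bool (Q u v) = p" "of_bool (Q u' v) = p"
        using row[of u] row[of u'] u v by (simp_all del: sum_of_bool_eq)
      then show ?thesis
        unfolding u v by (cases "P u v"; cases "P u' v"; cases "Q u v"; cases "Q u' v"; simp)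
    next
      case v: (3 v v')
      have P: "of_bool (P u v) + of_bool (P u v') = p" "of_bool (P u' v) + of_bool (P u' v') = p"
        "of_bool (P u v) + of_bool (P u' v) = q" "of_bool (P u v') + of_bool (P u' v') = q"
        using row(1)[of u] row(1)[of u'] col(1)[of v] col(1)[of v'] u v
        by (simp_all del: sum_of_bool_eq)
      have Q: "of_bool (Q u v) + of_bool (Q u v') = p" "of_bool (Q u' v) + of_bool (Q u' v') = p"
        "of_bool (Q u v) + of_bool (Q u' v) = q" "of_bool (Q u v') + of_bool (Q u' v') = q"
        using row(2)[of u] row(2)[of u'] col(2)[of v] col(2)[of v'] u v
        by (simp_all del: sum_of_bool_eq)
      \<comment> \<open>Equating the two row sums and the two column sums makes opposite corners
        equal. The first row then determines the relation, and two first rows with the same sum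
        \<open>p\<close> are equal or swapped.\<close>
      have "of_bool (P u' v) = (of_bool (P u v') :: nat)" "of_bool (P u' v') = (of_bool (P u v) :: nat)"
        using P by linarith+
      moreover have "of_bool (Q u' v) = (of_bool (Q u v') :: nat)" "of_bool (Q u' v') = (of_bool (Q u v) :: nat)"
        using Q by linarith+
      ultimately show ?thesis
        using P(1) Q(1) unfolding u v of_bool_eq_iff
        by (cases "P u v"; cases "P u v'"; cases "Q u v"; cases "Q u v'"; simp)
    qed
  qed
qed

section \<open>Schemes\<close>

lemma scheme_rel_exists:
  assumes "scheme d R"
  shows "\<exists>a\<le>d. (y, z) \<in> R a"
proof -
  have "(y, z) \<in> (\<Union>i\<in>{0..d}. R i)" using assms by (simp add: scheme_def)
  then show ?thesis by auto
qed

lemma scheme_rel_unique: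
  assumes "scheme d R" "a \<le> d" "b \<le> d" "(y, z) \<in> R a" "(y, z) \<in> R b"
  shows "a = b"
  using assms unfolding scheme_def by blast

lemma scheme_diag: "scheme d R \<Longrightarrow> (y, y) \<in> R 0"
  by (simp add: scheme_def)

lemma conv_idx:
  assumes "scheme d R" "a \<le> d"
  shows "conv_idx d R a \<le> d" "(e, f) \<in> R (conv_idx d R a) \<longleftrightarrow> (f, e) \<in> R a"
proof -
  have "\<exists>c'. c' \<le> d \<and> R c' = {(f, e). (e, f) \<in> R a}"
    using assms unfolding scheme_def by blast
  from someI_ex[OF this] show "conv_idx d R a \<le> d" "(e, f) \<in> R (conv_idx d R a) \<longleftrightarrow> (f, e) \<in> R a"
    unfolding conv_idx_def by auto
qed

lemma int_num_eq_p_num: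
  assumes "scheme d R" "i \<le> d" "j \<le> d" "k \<le> d" "(m, n) \<in> R k"
  shows "int_num R i j m n = p_num R i j k"
proof -
  have "\<exists>p. \<forall>(m, n)\<in>R k. int_num R i j m n = p"
    using assms unfolding scheme_def by blast
  from someI_ex[OF this] assms(5) show ?thesis
    unfolding p_num_def by auto
qed

text \<open>Evaluate the intersection number at the diagonal pair \<open>(y, y)\<close>: the
  condition on the second step only repeats that on the first.\<close>

lemma card_neighbours:
  assumes "scheme d R" "a \<le> d"
  shows "card {z. (y, z) \<in> R a} = valency d R a"
proof -
  have "int_num R a (conv_idx d R a) y y = valency d R a"
    unfolding valency_def using assms
    by (intro int_num_eq_p_num) (auto simp: conv_idx scheme_diag)
  with assms show ?thesis by (simp add: int_num_def conv_idx)
qed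

text \<open>Row \<open>i\<close> counts the two-step walks from \<open>y\<close> over
  \<open>j\<close> to \<open>i\<close>; the second step runs along \<open>R a\<close> backwards,
  whence the converse index.\<close>

lemma card_block_row:
  assumes "scheme d R" "a \<le> d" "b \<le> d" "c \<le> d" "(y, i) \<in> R b"
  shows "card {j\<in>{z. (y, z) \<in> R c}. (i, j) \<in> R a} = p_num R c (conv_idx d R a) b"
proof -
  have "int_num R c (conv_idx d R a) y i = p_num R c (conv_idx d R a) b"
    using assms by (intro int_num_eq_p_num) (auto simp: conv_idx)
  with assms show ?thesis by (simp add: int_num_def conv_idx)
qed

lemma card_block_col:
  assumes "scheme d R" "a \<le> d" "b \<le> d" "c \<le> d" "(y, j) \<in> R c"
  shows "card {i\<in>{z. (y, z) \<in> R b}. (i, j) \<in> R a} = p_num R b a c"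
  using int_num_eq_p_num[OF assms(1,3,2,4,5)] by (simp add: int_num_def)

text \<open>The sets of neighbours of \<open>x\<close> and those of \<open>y\<close> both partition
  the points, with sizes given by the valencies. Arbitrary bijections between corresponding classes
  are glued; the result need not be an automorphism of the scheme.\<close>

lemma ex_neighbour_bij:
  assumes "scheme d R"
  obtains \<sigma> where "bij \<sigma>" "\<And>a z. a \<le> d \<Longrightarrow> (y, \<sigma> z) \<in> R a \<longleftrightarrow> (x, z) \<in> R a"
proof -
  have "\<exists>f. bij_betw f {z. (x, z) \<in> R a} {z. (y, z) \<in> R a}" if "a \<le> d" for a
    using that assms by (intro finite_same_card_bij) (auto simp: card_neighbours)
  then obtain f where f: "\<And>a. a \<le> d \<Longrightarrow> bij_betw (f a) {z. (x, z) \<in> R a} {z. (y, z) \<in> R a}"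
    by metis
  obtain idx where idx: "\<And>z. idx z \<le> d" "\<And>z. (x, z) \<in> R (idx z)"
    using scheme_rel_exists[OF assms] by metis
  define \<sigma> where "\<sigma> z = f (idx z) z" for z
  have \<sigma>_idx: "(y, \<sigma> z) \<in> R (idx z)" for z
    using f[OF idx(1)[of z]] idx(2)[of z] by (auto simp: \<sigma>_def bij_betw_def)
  have iff: "(y, \<sigma> z) \<in> R a \<longleftrightarrow> (x, z) \<in> R a" if "a \<le> d" for a z
    using scheme_rel_unique[OF assms] \<sigma>_idx idx that by metis
  have "inj \<sigma>"
  proof (rule injI)
    fix u v
    assume eq: "\<sigma> u = \<sigma> v"
    then have "idx u = idx v"
      using scheme_rel_unique[OF assms idx(1) idx(1)] \<sigma>_idx by metis
    with eq show "u = v"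
      using f[OF idx(1)[of u]] idx(2)[of u] idx(2)[of v]
      by (auto simp: \<sigma>_def bij_betw_def inj_on_def)
  qed
  then have "bij \<sigma>" by (simp add: bij_def finite_UNIV_inj_surj)
  with iff that show ?thesis by blast
qed

section \<open>Blocks\<close>

text \<open>The block is padded with zeros to full size, so that it can be an element of the
  algebra.\<close>

definition block :: "(nat \<Rightarrow> ('a \<times> 'a) set) \<Rightarrow> 'a \<Rightarrow> nat \<Rightarrow> nat \<Rightarrow> ('a, 'f::field) xmat \<Rightarrow> ('a, 'f) xmat"
  where "block R y b c M = (\<lambda>i j. if (y, i) \<in> R b \<and> (y, j) \<in> R c then M i j else 0)"

lemma block_eq_mmult:
  "block R y b c M = mmult (mmult (dual_idem R y b) M) (dual_idem R y c)"
proof -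
  have left: "mmult (dual_idem R y b) M = (\<lambda>i j. if (y, i) \<in> R b then M i j else 0)"
  proof (intro ext)
    fix i j
    have "mmult (dual_idem R y b) M i j
        = (\<Sum>k\<in>UNIV. if k = i then (if (y, i) \<in> R b then M i j else 0) else 0)"
      unfolding mmult_def dual_idem_def by (intro sum.cong) auto
    then show "mmult (dual_idem R y b) M i j = (if (y, i) \<in> R b then M i j else 0)" by simp
  qed
  show ?thesis
  proof (intro ext)
    fix i j
    have "mmult (mmult (dual_idem R y b) M) (dual_idem R y c) i j
        = (\<Sum>k\<in>UNIV. if k = j then block R y b c M i j else 0)"
      unfolding left unfolding mmult_def dual_idem_def block_def by (intro sum.cong) auto
    then show "block R y b c M i j = mmult (mmult (dual_idem R y b) M) (dual_idem R y c) i j" by simp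
  qed
qed

lemma sum_blocks:
  assumes "scheme d R"
  shows "(\<lambda>i j. \<Sum>b\<le>d. \<Sum>c\<le>d. block R y b c M i j) = M"
proof (intro ext)
  fix i j
  obtain b c where b: "b \<le> d" "(y, i) \<in> R b" and c: "c \<le> d" "(y, j) \<in> R c"
    using scheme_rel_exists[OF assms] by metis
  have "block R y b' c' M i j = (if b' = b then if c' = c then M i j else 0 else 0)"
    if "b' \<le> d" "c' \<le> d" for b' c'
    using b c that scheme_rel_unique[OF assms] unfolding block_def by metis
  then have "(\<Sum>b'\<le>d. \<Sum>c'\<le>d. block R y b' c' M i j)
      = (\<Sum>b'\<le>d. \<Sum>c'\<le>d. if b' = b then if c' = c then M i j else 0 else 0)"
    by (intro sum.cong refl) auto
  also have "\<dots> = (\<Sum>b'\<le>d. if b' = b then (\<Sum>c'\<le>d. if c' = c then M i j else 0) else 0)"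
    by (intro sum.cong refl) auto
  also have "\<dots> = M i j" using b c by simp
  finally show "(\<Sum>b\<le>d. \<Sum>c\<le>d. block R y b c M i j) = M i j" .
qed

lemma adj_mat_terwilliger: "a \<le> d \<Longrightarrow> adj_mat R a \<in> terwilliger d R y"
  unfolding terwilliger_def by (intro gen_alg.gen) auto

lemma dual_idem_terwilliger: "a \<le> d \<Longrightarrow> dual_idem R y a \<in> terwilliger d R y"
  unfolding terwilliger_def by (intro gen_alg.gen) auto

lemma block_terwilliger:
  assumes "b \<le> d" "c \<le> d" "M \<in> terwilliger d R y"
  shows "block R y b c M \<in> terwilliger d R y"
  using assms dual_idem_terwilliger[of _ d R y] unfolding block_eq_mmult terwilliger_def
  by (intro gen_alg.mult) auto

text \<open>Membership may be tested block by block. This matters because the choice between a block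
  and its complement can differ from block to block.\<close>

lemma terwilligerI_blocks:
  assumes "scheme d R"
    and "\<And>b c. b \<le> d \<Longrightarrow> c \<le> d \<Longrightarrow> block R y b c M \<in> terwilliger d R y"
  shows "M \<in> terwilliger d R y"
proof -
  have "(\<lambda>i j. \<Sum>b\<le>d. \<Sum>c\<le>d. block R y b c M i j) \<in> terwilliger d R y"
    using assms(2) unfolding terwilliger_def
    by (intro gen_alg_sum[where f = "\<lambda>b i j. \<Sum>c\<le>d. block R y b c M i j"]
        gen_alg_sum[where f = "\<lambda>c. block R y b c M" for b]) auto
  then show ?thesis by (simp only: sum_blocks[OF assms(1)])
qed

text \<open>The relations partition all pairs, so the complement is the sum of the other adjacency
  matrices.\<close>

lemma complement_adj_mat_terwilliger:
  assumes "scheme d R" "a \<le> d"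
  shows "(\<lambda>i j. if (i, j) \<in> R a then 0 else 1) \<in> terwilliger d R y"
proof -
  have "(\<lambda>i j. \<Sum>c\<in>{..d} - {a}. adj_mat R c i j) \<in> terwilliger d R y"
    using adj_mat_terwilliger[of _ d R y] unfolding terwilliger_def
    by (intro gen_alg_sum) auto
  also have "(\<lambda>i j. \<Sum>c\<in>{..d} - {a}. adj_mat R c i j) = (\<lambda>i j. if (i, j) \<in> R a then 0 else 1)"
  proof (intro ext)
    fix i j
    obtain e where e: "e \<le> d" "(i, j) \<in> R e" using scheme_rel_exists[OF assms(1)] by metis
    have iff: "(i, j) \<in> R c \<longleftrightarrow> c = e" if "c \<le> d" for c
      using that e scheme_rel_unique[OF assms(1)] by blast
    have "(\<Sum>c\<in>{..d} - {a}. adj_mat R c i j) = (\<Sum>c\<in>{..d} - {a}. if c = e then 1 else 0)"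
      by (intro sum.cong) (auto simp: adj_mat_def iff)
    with e assms(2) show "(\<Sum>c\<in>{..d} - {a}. adj_mat R c i j) = (if (i, j) \<in> R a then 0 else 1)"
      by (auto simp: iff)
  qed
  finally show ?thesis .
qed

lemma reindex_terwilliger:
  fixes R :: "nat \<Rightarrow> ('a::finite \<times> 'a) set" and M :: "('a, 'f::field) xmat"
  assumes S: "scheme d R" and Q: "quasi_thin d R" and bij: "bij \<sigma>"
    and \<sigma>: "\<And>a z. a \<le> d \<Longrightarrow> (y, \<sigma> z) \<in> R a \<longleftrightarrow> (x, z) \<in> R a"
    and M: "M \<in> terwilliger d R y"
  shows "reindex \<sigma> M \<in> terwilliger d R x"
proof -
  have dual: "reindex \<sigma> (dual_idem R y a) = (dual_idem R x a :: ('a, 'f) xmat)" if "a \<le> d" for a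
    using \<sigma>[OF that] bij_is_inj[OF bij]
    by (auto simp: reindex_def dual_idem_def fun_eq_iff dest: injD)
  have adj: "reindex \<sigma> (adj_mat R a) \<in> (terwilliger d R x :: ('a, 'f) xmat set)"
    if a: "a \<le> d" for a
  proof (rule terwilligerI_blocks[OF S])
    fix b c
    assume b: "b \<le> d" and c: "c \<le> d"
    let ?N = "\<lambda>e. {z. (x, z) \<in> R e}"
    \<comment> \<open>Counts around \<open>x\<close> taken through \<open>\<sigma>\<close> are
      counts around \<open>y\<close>, to which the intersection numbers apply.\<close>
    have card: "card {z\<in>?N e. P (\<sigma> z)} = card {z\<in>{z. (y, z) \<in> R e}. P z}" if "e \<le> d" for e P
    proof -
      have "{z\<in>?N e. P (\<sigma> z)} = \<sigma> -` {z\<in>{z. (y, z) \<in> R e}. P z}"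
        using \<sigma>[OF that] by auto
      moreover have "card (\<sigma> -` {z\<in>{z. (y, z) \<in> R e}. P z}) = card {z\<in>{z. (y, z) \<in> R e}. P z}"
        using bij by (intro card_vimage_inj) (simp_all add: bij_is_inj bij_is_surj)
      ultimately show ?thesis by simp
    qed
    have valency: "card (?N e) \<le> 2" if "e \<le> d" for e
      using that Q card_neighbours[OF S that, of x] by (simp add: quasi_thin_def)
    have "(\<forall>i\<in>?N b. \<forall>j\<in>?N c. (\<sigma> i, \<sigma> j) \<in> R a \<longleftrightarrow> (i, j) \<in> R a) \<or>
          (\<forall>i\<in>?N b. \<forall>j\<in>?N c. (\<sigma> i, \<sigma> j) \<in> R a \<longleftrightarrow> \<not> (i, j) \<in> R a)"
    proof (rule biregular_unique_up_to_complement)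
      show "card {j\<in>?N c. (\<sigma> i, \<sigma> j) \<in> R a} = p_num R c (conv_idx d R a) b" if "i \<in> ?N b" for i
        using card[OF c, of "\<lambda>j. (\<sigma> i, j) \<in> R a"] card_block_row[OF S a b c, of y "\<sigma> i"] that \<sigma>[OF b]
        by simp
      show "card {i\<in>?N b. (\<sigma> i, \<sigma> j) \<in> R a} = p_num R b a c" if "j \<in> ?N c" for j
        using card[OF b, of "\<lambda>i. (i, \<sigma> j) \<in> R a"] card_block_col[OF S a b c, of y "\<sigma> j"] that \<sigma>[OF c]
        by simp
      show "card {j\<in>?N c. (i, j) \<in> R a} = p_num R c (conv_idx d R a) b" if "i \<in> ?N b" for i
        using card_block_row[OF S a b c] that by simp
      show "card {i\<in>?N b. (i, j) \<in> R a} = p_num R b a c" if "j \<in> ?N c" for j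
        using card_block_col[OF S a b c] that by simp
    qed (use b c valency in auto)
    then have "block R x b c (reindex \<sigma> (adj_mat R a)) = block R x b c (adj_mat R a :: ('a, 'f) xmat) \<or>
      block R x b c (reindex \<sigma> (adj_mat R a)) =
        block R x b c (\<lambda>i j. if (i, j) \<in> R a then 0 else 1 :: 'f)"
      by (elim disjE) (auto simp: block_def reindex_def adj_mat_def fun_eq_iff)
    then show "block R x b c (reindex \<sigma> (adj_mat R a)) \<in> (terwilliger d R x :: ('a, 'f) xmat set)"
      using block_terwilliger[OF b c adj_mat_terwilliger[OF a]]
        block_terwilliger[OF b c complement_adj_mat_terwilliger[OF S a]] by metis
  qed
  show ?thesis
    using M unfolding terwilliger_def
  proof (rule reindex_gen_alg[OF bij, rotated])
    fix N :: "('a, 'f) xmat"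
    assume "N \<in> {adj_mat R a |a. a \<le> d} \<union> {dual_idem R y a |a. a \<le> d}"
    then show "reindex \<sigma> N \<in> gen_alg ({adj_mat R a |a. a \<le> d} \<union> {dual_idem R x a |a. a \<le> d})"
      \<comment> \<open>Dual idempotents go to dual idempotents exactly; adjacency matrices only
        land in the algebra.\<close>
      using adj dual dual_idem_terwilliger[of _ d R x] unfolding terwilliger_def by fastforce
  qed
qed

theorem theoremD:
  fixes d :: nat and R :: "nat \<Rightarrow> ('a::finite \<times> 'a) set" and x :: 'a
  assumes "scheme d R" and "quasi_thin d R"
  shows "\<forall>y. \<exists>\<phi> :: ('a, 'f::field) xmat \<Rightarrow> ('a, 'f) xmat.
           alg_iso (terwilliger d R y) (terwilliger d R x) \<phi>"
proof
  fix y
  obtain \<sigma> where bij: "bij \<sigma>" and \<sigma>: "\<And>a z. a \<le> d \<Longrightarrow> (y, \<sigma> z) \<in> R a \<longleftrightarrow> (x, z) \<in> R a"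
    using ex_neighbour_bij[OF assms(1)] by metis
  \<comment> \<open>The inverse satisfies the same condition with \<open>x\<close> and
    \<open>y\<close> exchanged, so one lemma serves both directions.\<close>
  have inv_\<sigma>: "(x, inv \<sigma> z) \<in> R a \<longleftrightarrow> (y, z) \<in> R a" if "a \<le> d" for a z
    using \<sigma>[OF that, of "inv \<sigma> z"] bij_is_surj[OF bij] by (simp add: surj_f_inv_f)
  have "alg_iso (terwilliger d R y) (terwilliger d R x :: ('a, 'f) xmat set) (reindex \<sigma>)"
    using bij
  proof (rule alg_iso_reindex)
    show "reindex \<sigma> M \<in> terwilliger d R x" if "M \<in> terwilliger d R y" for M :: "('a, 'f) xmat"
      using reindex_terwilliger[OF assms bij \<sigma> that] .
    show "reindex (inv \<sigma>) M \<in> terwilliger d R y" if "M \<in> terwilliger d R x" for M :: "('a, 'f) xmat"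
      using reindex_terwilliger[OF assms bij_imp_bij_inv[OF bij] inv_\<sigma> that] .
  qed
  then show "\<exists>\<phi> :: ('a, 'f) xmat \<Rightarrow> ('a, 'f) xmat.
      alg_iso (terwilliger d R y) (terwilliger d R x) \<phi>" by blast
qed

end
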